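(* Let $f:[0,\infty)\to[0,\infty)$, $K>0$ and $M\ge 1$ satisfy Assumption A (stated in the context). Let $a\in\left(1-\frac1M,1\right)$ and let $\{\alpha_n\}_{n\in\mathbb{N}_0}$ be a real sequence with $\alpha_n\in[a,1)$ for every $n\in\mathbb{N}_0$. Let $\{x_n\}_{n\in\mathbb{N}_0}$ be any solution of $$x_{n+1}=F_{\alpha_n}(x_n),\qquad n\in\mathbb{N}_0,$$ with $x_0>0$. Then: (i) the sequence $\{|x_n-K|\}_{n\in\mathbb{N}_0}$ is non-increasing; (ii) if there is $b\in(0,1)$ such that $\alpha_n\le b<1$ for all $n\in\mathbb{N}_0$, then for any $x_0>0$, $\lim_{n\to\infty}x_n=K$; (iii) if, in addition to the hypothesis of (ii), Assumption B (stated in the context) holds with the point $c$, then there exists $n_0\in\mathbb{N}_0$ such that for all $n\ge n_0$ we have $x_n\ge c$ and $$|x_{n+1}-K|=|F_{\alpha_n}(x_n)-K|\le\gamma\,|x_n-K|,\qquad\text{where } \gamma=\max\{b,1-a\}.$$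
   Context: $\mathbb{N}_0=\{0,1,2,\dots\}$. Assumption A: $f:[0,\infty)\to[0,\infty)$ is a continuous function, $f(x)>0$ for $x>0$, $f(x)>x$ for $x\in(0,K)$, $f(x)<x$ for $x>K$, and $M\ge1$ is a constant such that $|f(x)-K|\le M|x-K|$ for all $x\ge 0$. (Hence $K>0$ is the unique positive fixed point of $f$.) Assumption B: there is a point $c\in[0,K)$ such that $f$ is strictly decreasing on $[c,\infty)$. For a real number $\alpha$, $F_\alpha(x):=\alpha x+(1-\alpha)f(x)$. *)

theory Defs
  imports Complex_Main
begin

(* Functions on [0,infinity) are total functions on the reals of which only the
   values on {0..} are constrained. *)

definition assumption_A :: "(real \<Rightarrow> real) \<Rightarrow> real \<Rightarrow> real \<Rightarrow> bool" where
  "assumption_A f K M \<longleftrightarrow>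
     (\<forall>x\<in>{0..}. f x \<in> {0..}) \<and> continuous_on {0..} f \<and>
     (\<forall>x>0. f x > 0) \<and> (\<forall>x\<in>{0<..<K}. f x > x) \<and> (\<forall>x>K. f x < x) \<and>
     M \<ge> 1 \<and> (\<forall>x\<ge>0. \<bar>f x - K\<bar> \<le> M * \<bar>x - K\<bar>)"

definition assumption_B :: "(real \<Rightarrow> real) \<Rightarrow> real \<Rightarrow> real \<Rightarrow> bool" where
  "assumption_B f K c \<longleftrightarrow> c \<in> {0..<K} \<and> strict_antimono_on {c..} f"

definition F :: "(real \<Rightarrow> real) \<Rightarrow> real \<Rightarrow> real \<Rightarrow> real" where
  "F f \<alpha> x = \<alpha> * x + (1 - \<alpha>) * f x"

end

theory Submission
  imports Defs
begin

text \<open>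
  Everything is measured by the deviation \<open>t = y - K\<close> of a point from the equilibrium and the
  deviation \<open>s = f y - K\<close> of its image; one step of the recursion replaces \<open>t\<close> by the
  average \<open>\<alpha> * t + (1 - \<alpha>) * s\<close>. The conditions on the sign of \<open>f y - y\<close> say that \<open>f\<close> moves
  \<open>y\<close> in the direction of \<open>K\<close>, so the average cannot exceed \<open>t\<close> on the side of \<open>K\<close> where \<open>y\<close>
  lies. The step can overshoot \<open>K\<close>, but \<open>\<bar>s\<bar> \<le> M * \<bar>t\<bar>\<close> together with \<open>(1 - \<alpha>) * M < 1\<close> keeps
  the overshoot shorter than \<open>\<bar>t\<bar>\<close>. Hence every step brings a positive point other than \<open>K\<close>
  strictly closer to \<open>K\<close> (\<open>F_strictly_closer\<close>), which gives monotonicity of the deviations.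

  Strict decrease alone does not give convergence, because the \<open>\<alpha> n\<close> vary. When they stay in
  \<open>{a..b}\<close>, the average is affine in \<open>\<alpha>\<close>, so its absolute value is at most the larger of its
  values for \<open>a\<close> and for \<open>b\<close>. This yields a single continuous \<open>g\<close> that bounds the next deviation
  and satisfies \<open>g y < \<bar>y - K\<bar>\<close> for positive \<open>y \<noteq> K\<close>; a subsequential limit other than \<open>K\<close> would
  then contradict the convergence of the deviations (\<open>tendsto_if_dominated_by_closer\<close>).

  If \<open>f\<close> is moreover decreasing on a half-line that starts to the left of \<open>K\<close>, then, once the
  sequence has entered it, \<open>s\<close> and \<open>t\<close> have opposite signs. On the side of \<open>y\<close> only the
  term \<open>\<alpha> * t\<close>, which is at most \<open>b * \<bar>t\<bar>\<close> in size, counts; on the other side the overshoot is at most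
  \<open>((1 - \<alpha>) * M - \<alpha>) * \<bar>t\<bar>\<close>, and this is at most \<open>(1 - a) * \<bar>t\<bar>\<close>.
\<close>

section \<open>Averages of two deviations\<close>

lemma abs_average_less:
  fixes t s \<alpha> M :: real
  assumes "t \<noteq> 0" "0 < \<alpha>" "\<alpha> < 1" "(1 - \<alpha>) * M < 1" "\<bar>s\<bar> \<le> M * \<bar>t\<bar>"
    and right: "0 < t \<Longrightarrow> s < t" and left: "t < 0 \<Longrightarrow> t < s"
  shows "\<bar>\<alpha> * t + (1 - \<alpha>) * s\<bar> < \<bar>t\<bar>"
proof -
  have "(1 - \<alpha>) * \<bar>s\<bar> \<le> (1 - \<alpha>) * (M * \<bar>t\<bar>)"
    using assms by (intro mult_left_mono) auto
  also have "\<dots> < \<bar>t\<bar>"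
    using mult_strict_right_mono[of "(1 - \<alpha>) * M" 1 "\<bar>t\<bar>"] assms by (simp add: mult.assoc)
  finally have overshoot: "\<bar>(1 - \<alpha>) * s\<bar> < \<bar>t\<bar>"
    using assms by (simp add: abs_mult)
  show ?thesis
  proof (cases "0 < t")
    case True
    have "(1 - \<alpha>) * s < (1 - \<alpha>) * t"
      using assms right[OF True] by simp
    moreover have "0 < \<alpha> * t" using True assms by simp
    ultimately show ?thesis using overshoot True by (simp add: algebra_simps abs_less_iff)
  next
    case False
    then have "t < 0" using assms by simp
    then have "(1 - \<alpha>) * t < (1 - \<alpha>) * s"
      using assms left by simp
    moreover have "\<alpha> * t < 0" using \<open>t < 0\<close> assms by (simp add: mult_pos_neg)
    ultimately show ?thesis using overshoot \<open>t < 0\<close> by (simp add: algebra_simps abs_less_iff)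
  qed
qed

lemma abs_average_le_max_endpoints:
  fixes t s a b \<alpha> :: real
  assumes "a \<le> \<alpha>" "\<alpha> \<le> b"
  shows "\<bar>\<alpha> * t + (1 - \<alpha>) * s\<bar> \<le> max \<bar>a * t + (1 - a) * s\<bar> \<bar>b * t + (1 - b) * s\<bar>"
proof -
  have affine: "\<beta> * t + (1 - \<beta>) * s = s + \<beta> * (t - s)" for \<beta>
    by (simp add: algebra_simps)
  show ?thesis
  proof (cases "s \<le> t")
    case True
    then have "a * (t - s) \<le> \<alpha> * (t - s)" "\<alpha> * (t - s) \<le> b * (t - s)"
      using assms by (auto intro: mult_right_mono)
    then show ?thesis unfolding affine by linarith
  next
    case False
    then have "\<alpha> * (t - s) \<le> a * (t - s)" "b * (t - s) \<le> \<alpha> * (t - s)"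
      using assms by (auto intro: mult_right_mono_neg)
    then show ?thesis unfolding affine by linarith
  qed
qed

text \<open>
  When the two deviations have opposite signs, the average is bounded by \<open>\<alpha> * \<bar>t\<bar>\<close> on the side of
  \<open>t\<close> and by \<open>((1 - \<alpha>) * M - \<alpha>) * \<bar>t\<bar>\<close> on the side of \<open>s\<close>. Since \<open>(1 - a) * M \<le> 1\<close> and \<open>a \<le> \<alpha>\<close>,
  the second factor is at most \<open>1 - a\<close>.
\<close>

lemma abs_average_opposite_signs:
  fixes t s a b \<alpha> M :: real
  assumes "0 \<le> M" "a \<le> \<alpha>" "\<alpha> \<le> b" "\<alpha> \<le> 1" "(1 - a) * M \<le> 1" "\<bar>s\<bar> \<le> M * \<bar>t\<bar>"
    and right: "0 \<le> t \<Longrightarrow> s \<le> 0" and left: "t \<le> 0 \<Longrightarrow> 0 \<le> s"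
  shows "\<bar>\<alpha> * t + (1 - \<alpha>) * s\<bar> \<le> max b (1 - a) * \<bar>t\<bar>"
proof -
  have "(1 - \<alpha>) * M \<le> (1 - a) * M"
    using assms by (intro mult_right_mono) auto
  then have factor: "(1 - \<alpha>) * M - \<alpha> \<le> 1 - a"
    using assms by linarith
  have "(1 - \<alpha>) * \<bar>s\<bar> \<le> (1 - \<alpha>) * (M * \<bar>t\<bar>)"
    using assms by (intro mult_left_mono) auto
  then have "(1 - \<alpha>) * \<bar>s\<bar> - \<alpha> * \<bar>t\<bar> \<le> ((1 - \<alpha>) * M - \<alpha>) * \<bar>t\<bar>"
    by (simp add: algebra_simps)
  also have "\<dots> \<le> max b (1 - a) * \<bar>t\<bar>"
    using factor by (intro mult_right_mono) auto
  finally have across: "(1 - \<alpha>) * \<bar>s\<bar> - \<alpha> * \<bar>t\<bar> \<le> max b (1 - a) * \<bar>t\<bar>" .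
  have "\<alpha> * \<bar>t\<bar> \<le> max b (1 - a) * \<bar>t\<bar>"
    using assms by (intro mult_right_mono) auto
  moreover have "0 \<le> (1 - \<alpha>) * \<bar>s\<bar>" using assms by simp
  ultimately have same_side: "\<alpha> * \<bar>t\<bar> - (1 - \<alpha>) * \<bar>s\<bar> \<le> max b (1 - a) * \<bar>t\<bar>"
    by linarith
  have "\<bar>\<alpha> * t + (1 - \<alpha>) * s\<bar> = \<bar>\<alpha> * \<bar>t\<bar> - (1 - \<alpha>) * \<bar>s\<bar>\<bar>"
  proof (cases "0 \<le> t")
    case True
    then show ?thesis using right by simp
  next
    case False
    then show ?thesis using left by simp
  qed
  then show ?thesis using across same_side by linarith
qed

section \<open>Convergence from a continuous bound on the deviation\<close>

text \<open>
  A decreasing deviation from \<open>K\<close> does not by itself keep a positive sequence away from \<open>0\<close>, since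
  the initial deviation may exceed \<open>K\<close>. But if some term lies to the left of \<open>K\<close>, then no
  later term lies to the left of it; and if no term does, then \<open>K\<close> itself is a lower bound.
\<close>

lemma eventually_bounded_away_from_0:
  fixes x :: "nat \<Rightarrow> real" and K :: real
  assumes "0 < K" "\<And>n. 0 < x n" and dec: "decseq (\<lambda>n. \<bar>x n - K\<bar>)"
  obtains \<delta> N where "0 < \<delta>" "\<And>n. N \<le> n \<Longrightarrow> \<delta> \<le> x n"
proof (cases "\<exists>m. x m < K")
  case True
  then obtain m where m: "x m < K" ..
  have "x m \<le> x n" if "m \<le> n" for n
    using decseqD[OF dec that] m by linarith
  then show ?thesis using that assms by blast
next
  case False
  then show ?thesis using that[of K 0] assms by (meson not_le)
qed

lemma tendsto_if_dominated_by_closer: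
  fixes x :: "nat \<Rightarrow> real" and K :: real and g :: "real \<Rightarrow> real"
  assumes "0 < K" and pos: "\<And>n. 0 < x n" and dec: "decseq (\<lambda>n. \<bar>x n - K\<bar>)"
    and cont: "\<And>y. 0 < y \<Longrightarrow> isCont g y"
    and closer: "\<And>y. 0 < y \<Longrightarrow> y \<noteq> K \<Longrightarrow> g y < \<bar>y - K\<bar>"
    and dominated: "\<And>n. \<bar>x (Suc n) - K\<bar> \<le> g (x n)"
  shows "x \<longlonglongrightarrow> K"
proof -
  obtain d where d: "(\<lambda>n. \<bar>x n - K\<bar>) \<longlonglongrightarrow> d"
    using decseq_convergent[OF dec, of 0] by auto
  have "\<bar>x n\<bar> \<le> \<bar>x 0 - K\<bar> + \<bar>K\<bar>" for n
    using decseqD[OF dec, of 0 n] by linarith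
  then have "Bseq x" by (intro BseqI'[where K = "\<bar>x 0 - K\<bar> + \<bar>K\<bar>"]) simp
  obtain r where r: "strict_mono r" "monoseq (\<lambda>k. x (r k))"
    using seq_monosub by blast
  have "convergent (\<lambda>k. x (r k))"
    using r \<open>Bseq x\<close> by (intro Bseq_monoseq_convergent) (auto intro: Bseq_subseq)
  then obtain L where L: "(\<lambda>k. x (r k)) \<longlonglongrightarrow> L"
    by (auto simp: convergent_def)
  obtain \<delta> N where \<delta>: "0 < \<delta>" "\<And>n. N \<le> n \<Longrightarrow> \<delta> \<le> x n"
    using eventually_bounded_away_from_0[of K x] assms by blast
  have "\<delta> \<le> x (r k)" if "N \<le> k" for k
    using \<delta>(2) seq_suble[OF r(1), of k] that by simp
  then have "\<delta> \<le> L" using LIMSEQ_le_const[OF L] by blast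
  then have "0 < L" using \<delta> by simp
  have "(\<lambda>k. \<bar>x (r k) - K\<bar>) \<longlonglongrightarrow> \<bar>L - K\<bar>"
    using L by (intro tendsto_intros)
  then have dL: "d = \<bar>L - K\<bar>"
    using LIMSEQ_unique LIMSEQ_subseq_LIMSEQ[OF d r(1)] by (fastforce simp: o_def)
  have "(\<lambda>k. g (x (r k))) \<longlonglongrightarrow> g L"
    using isCont_tendsto_compose[OF cont[OF \<open>0 < L\<close>] L] .
  moreover have "d \<le> g (x (r k))" for k
    using decseq_ge[OF dec d, of "Suc (r k)"] dominated[of "r k"] by linarith
  ultimately have "d \<le> g L" by (intro LIMSEQ_le_const) auto
  then have "L = K" using closer[OF \<open>0 < L\<close>] dL by force
  then have "(\<lambda>n. \<bar>x n - K\<bar>) \<longlonglongrightarrow> 0" using d dL by simp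
  then show ?thesis
    using LIM_zero_cancel tendsto_rabs_zero_iff by blast
qed

section \<open>The averaged map\<close>

lemma F_deviation: "F f \<alpha> y - K = \<alpha> * (y - K) + (1 - \<alpha>) * (f y - K)"
  by (simp add: F_def algebra_simps)

lemma F_pos:
  assumes "assumption_A f K M" "0 < \<alpha>" "\<alpha> < 1" "0 < y"
  shows "0 < F f \<alpha> y"
  using assms by (simp add: F_def assumption_A_def add_pos_pos)

lemma F_strictly_closer:
  assumes A: "assumption_A f K M" and "0 < \<alpha>" "\<alpha> < 1" "(1 - \<alpha>) * M < 1" "0 < y" "y \<noteq> K"
  shows "\<bar>F f \<alpha> y - K\<bar> < \<bar>y - K\<bar>"
  unfolding F_deviation
  by (rule abs_average_less[where M = M]) (use assms in \<open>auto simp: assumption_A_def\<close>)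

text \<open>
  In \<open>assumption_A\<close>, the Lipschitz-type inequality at \<open>y = K\<close> is what makes \<open>K\<close> a fixed point.
\<close>

lemma assumption_A_fixed_point:
  assumes "assumption_A f K M" "0 \<le> K"
  shows "f K = K"
  using assms by (auto simp: assumption_A_def dest: spec[of _ K])

lemma isCont_F:
  assumes "assumption_A f K M" "0 < y"
  shows "isCont (F f \<alpha>) y"
proof -
  have "continuous_on {0<..} f"
    using assms by (auto simp: assumption_A_def intro: continuous_on_subset)
  then have "isCont f y"
    using assms by (simp add: continuous_on_eq_continuous_at)
  then show ?thesis unfolding F_def by (intro continuous_intros)
qed

lemma F_contraction_on_decreasing_part:
  assumes A: "assumption_A f K M" and B: "assumption_B f K c"
    and "a \<le> \<alpha>" "\<alpha> \<le> b" "\<alpha> \<le> 1" "(1 - a) * M \<le> 1" "c \<le> y"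
  shows "\<bar>F f \<alpha> y - K\<bar> \<le> max b (1 - a) * \<bar>y - K\<bar>"
proof -
  have c: "0 \<le> c" "c < K" and anti: "strict_antimono_on {c..} f"
    using B by (auto simp: assumption_B_def)
  have fK: "f K = K" using assumption_A_fixed_point[OF A] c by simp
  have "f y \<le> K" if "K \<le> y"
    using monotone_onD[OF anti, of K y] that c fK by (cases "y = K") auto
  moreover have "K \<le> f y" if "y \<le> K"
    using monotone_onD[OF anti, of y K] that c fK \<open>c \<le> y\<close> by (cases "y = K") auto
  moreover have "0 \<le> M" "\<bar>f y - K\<bar> \<le> M * \<bar>y - K\<bar>"
    using A c \<open>c \<le> y\<close> by (auto simp: assumption_A_def)
  ultimately show ?thesis
    unfolding F_deviation using assms by (intro abs_average_opposite_signs[where M = M]) auto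
qed

section \<open>Stabilization of the positive equilibrium\<close>

theorem lemma2p1:
  fixes f :: "real \<Rightarrow> real" and K M a :: real and \<alpha> x :: "nat \<Rightarrow> real"
  assumes "K > 0"
    and "assumption_A f K M"
    and "a \<in> {1 - 1 / M<..<1}"
    and "\<forall>n. \<alpha> n \<in> {a..<1}"
    and "x 0 > 0"
    and "\<forall>n. x (Suc n) = F f (\<alpha> n) (x n)"
  shows "decseq (\<lambda>n. \<bar>x n - K\<bar>)
    \<and> (\<forall>b\<in>{0<..<1}. (\<forall>n. \<alpha> n \<le> b) \<longrightarrow> x \<longlonglongrightarrow> K)
    \<and> (\<forall>b\<in>{0<..<1}. \<forall>c. (\<forall>n. \<alpha> n \<le> b) \<longrightarrow> assumption_B f K c \<longrightarrow>
         (\<exists>n0. \<forall>n\<ge>n0. x n \<ge> c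
            \<and> \<bar>x (Suc n) - K\<bar> = \<bar>F f (\<alpha> n) (x n) - K\<bar>
            \<and> \<bar>F f (\<alpha> n) (x n) - K\<bar> \<le> max b (1 - a) * \<bar>x n - K\<bar>))"
proof -
  note A = assms(2)
  have step: "x (Suc n) = F f (\<alpha> n) (x n)" for n using assms(6) by blast
  have \<alpha>: "a \<le> \<alpha> n" "\<alpha> n < 1" for n using assms(4) by auto
  have M: "1 \<le> M" using A by (simp add: assumption_A_def)
  have "1 / M \<le> 1" using M by simp
  then have a: "0 < a" "a < 1" using assms(3) by (auto simp del: divide_le_eq_1)
  have "(1 - a) < 1 / M" using assms(3) by auto
  then have aM: "(1 - a) * M < 1" using M by (simp add: field_simps)
  have closer: "\<bar>F f \<beta> y - K\<bar> < \<bar>y - K\<bar>" if "a \<le> \<beta>" "\<beta> < 1" "0 < y" "y \<noteq> K" for \<beta> y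
  proof -
    have "(1 - \<beta>) * M \<le> (1 - a) * M" using that M by (intro mult_right_mono) auto
    then show ?thesis using F_strictly_closer[OF A] that a aM by auto
  qed
  have pos: "0 < x n" for n
  proof (induction n)
    case 0
    show ?case by (fact assms(5))
  next
    case (Suc n)
    have "0 < \<alpha> n" using \<alpha>(1)[of n] a by linarith
    then show ?case using F_pos[OF A] Suc \<alpha>(2) by (simp add: step)
  qed
  have dec: "decseq (\<lambda>n. \<bar>x n - K\<bar>)"
  proof (rule decseq_SucI)
    fix n
    show "\<bar>x (Suc n) - K\<bar> \<le> \<bar>x n - K\<bar>"
    proof (cases "x n = K")
      case True
      then show ?thesis
        using assumption_A_fixed_point[OF A] assms(1) by (simp add: step F_deviation)
    next
      case False
      then show ?thesis using closer[OF \<alpha> pos] by (simp add: step less_imp_le)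
    qed
  qed
  have lim: "x \<longlonglongrightarrow> K" if b: "b < 1" "\<forall>n. \<alpha> n \<le> b" for b
  proof (rule tendsto_if_dominated_by_closer[where g = "\<lambda>y. max \<bar>F f a y - K\<bar> \<bar>F f b y - K\<bar>"])
    have "a \<le> b" using \<alpha>(1)[of 0] b(2) by (meson order_trans)
    then show "max \<bar>F f a y - K\<bar> \<bar>F f b y - K\<bar> < \<bar>y - K\<bar>" if "0 < y" "y \<noteq> K" for y
      using closer that a b by simp
    show "isCont (\<lambda>y. max \<bar>F f a y - K\<bar> \<bar>F f b y - K\<bar>) y" if "0 < y" for y
      using isCont_F[OF A that] by (intro continuous_intros) auto
    show "\<bar>x (Suc n) - K\<bar> \<le> max \<bar>F f a (x n) - K\<bar> \<bar>F f b (x n) - K\<bar>" for n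
      unfolding step F_deviation using \<alpha>(1) b(2) by (intro abs_average_le_max_endpoints) auto
  qed (use assms(1) pos dec in auto)
  have "\<exists>n0. \<forall>n\<ge>n0. c \<le> x n
      \<and> \<bar>x (Suc n) - K\<bar> = \<bar>F f (\<alpha> n) (x n) - K\<bar>
      \<and> \<bar>F f (\<alpha> n) (x n) - K\<bar> \<le> max b (1 - a) * \<bar>x n - K\<bar>"
    if b: "b < 1" "\<forall>n. \<alpha> n \<le> b" and B: "assumption_B f K c" for b c
  proof -
    have "c < K" using B by (simp add: assumption_B_def)
    then obtain n0 where n0: "\<forall>n\<ge>n0. c < x n"
      using order_tendstoD(1)[OF lim[OF b]] unfolding eventually_sequentially by blast
    have "\<bar>F f (\<alpha> n) (x n) - K\<bar> \<le> max b (1 - a) * \<bar>x n - K\<bar>" if "n0 \<le> n" for n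
      using F_contraction_on_decreasing_part[OF A B \<alpha>(1), of n b "x n"] b(2) \<alpha>(2)[of n] aM n0 that
      by (auto simp: less_imp_le)
    then show ?thesis using n0 step by (intro exI[of _ n0]) (simp add: less_imp_le)
  qed
  then show ?thesis using dec lim by auto
qed

end
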